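(* Let $(\Omega,\Sigma,\mu)$ be a measure space, $\mathbb{K}=\mathbb{C}$ or $\mathbb{R}$, and $\lambda\in(0,1)$. Let $f,g,h\in L^2(\Omega,\mathbb{K})$ and $\gamma,\Gamma\in\mathbb{K}$ with $\int_\Omega|h(s)|^2\,d\mu(s)=1$, and set $$I:=\int_\Omega\operatorname{Re}\left[f(s)\overline{g(s)}\right]d\mu(s)-\operatorname{Re}\left[\int_\Omega f(s)\overline{h(s)}\,d\mu(s)\cdot\int_\Omega h(s)\overline{g(s)}\,d\mu(s)\right].$$ (i) If $$\int_\Omega\operatorname{Re}\left\{\left[\Gamma h(s)-(\lambda f(s)+(1-\lambda)g(s))\right]\left[\lambda\overline{f(s)}+(1-\lambda)\overline{g(s)}-\overline{\gamma}\,\overline{h(s)}\right]\right\}d\mu(s)\ge0,$$ or, equivalently, $$\left(\int_\Omega\left|\lambda f(s)+(1-\lambda)g(s)-\frac{\gamma+\Gamma}{2}h(s)\right|^2d\mu(s)\right)^{1/2}\le\frac12|\Gamma-\gamma|,$$ then $$I\le\frac1{16}\cdot\frac1{\lambda(1-\lambda)}|\Gamma-\gamma|^2.$$ The constant $\frac1{16}$ is best possible (i.e. no constant smaller than $\frac1{16}$ makes the inequality valid for all such measure spaces, functions, scalars and $\lambda\in(0,1)$). (ii) If, for both choices of the sign $\pm$ (the same sign being used throughout), $$\int_\Omega\operatorname{Re}\left\{\left[\Gamma h(s)-(\lambda f(s)\pm(1-\lambda)g(s))\right]\left[\lambda\overline{f(s)}\pm(1-\lambda)\overline{g(s)}-\overline{\gamma}\,\overline{h(s)}\right]\right\}d\mu(s)\ge0,$$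 or, equivalently, $$\left(\int_\Omega\left|\lambda f(s)\pm(1-\lambda)g(s)-\frac{\gamma+\Gamma}{2}h(s)\right|^2d\mu(s)\right)^{1/2}\le\frac12|\Gamma-\gamma|,$$ then $$|I|\le\frac1{16}\cdot\frac1{\lambda(1-\lambda)}|\Gamma-\gamma|^2.$$
   Context: $(\Omega,\Sigma,\mu)$ consists of a set $\Omega$, a $\sigma$-algebra $\Sigma$ of subsets of $\Omega$ and a countably additive positive measure $\mu$ on $\Sigma$ with values in $\mathbb{R}\cup\{\infty\}$. $L^2(\Omega,\mathbb{K})$ is the Hilbert space of all $\mathbb{K}$-valued functions $f$ on $\Omega$ that are 2-integrable, i.e. $\int_\Omega|f(s)|^2\,d\mu(s)<\infty$. *)

theory Defs
  imports "HOL-Analysis.Analysis"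
begin

text \<open>
  The scalar field is a set \<open>K\<close> of complex numbers, either \<^term>\<open>UNIV :: complex set\<close> or
  \<^term>\<open>\<real> :: complex set\<close>, so that \<^const>\<open>Re\<close> and \<^const>\<open>cnj\<close> make sense in both cases.
  Elements of \<open>L2_space M K\<close> are functions rather than classes modulo null sets.
\<close>

definition L2_space :: "'a measure \<Rightarrow> complex set \<Rightarrow> ('a \<Rightarrow> complex) set" where
  "L2_space M K = {f \<in> borel_measurable M.
     (\<forall>s \<in> space M. f s \<in> K) \<and> integrable M (\<lambda>s. (cmod (f s))\<^sup>2)}"

definition gruss_setting ::
  "complex set \<Rightarrow> 'a measure \<Rightarrow> real \<Rightarrow> ('a \<Rightarrow> complex) \<Rightarrow> ('a \<Rightarrow> complex) \<Rightarrow> ('a \<Rightarrow> complex)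
     \<Rightarrow> complex \<Rightarrow> complex \<Rightarrow> bool" where
  "gruss_setting K M lam f g h \<gamma> \<Gamma> \<longleftrightarrow>
     0 < lam \<and> lam < 1 \<and>
     f \<in> L2_space M K \<and> g \<in> L2_space M K \<and> h \<in> L2_space M K \<and>
     \<gamma> \<in> K \<and> \<Gamma> \<in> K \<and>
     (LINT s|M. (cmod (h s))\<^sup>2) = 1"

definition gruss_functional ::
  "'a measure \<Rightarrow> ('a \<Rightarrow> complex) \<Rightarrow> ('a \<Rightarrow> complex) \<Rightarrow> ('a \<Rightarrow> complex) \<Rightarrow> real" where
  "gruss_functional M f g h =
     (LINT s|M. Re (f s * cnj (g s)))
     - Re ((LINT s|M. f s * cnj (h s)) * (LINT s|M. h s * cnj (g s)))"

text \<open>In the next two conditions \<open>\<sigma>\<close> is the sign \<open>\<plusminus>\<close>, i.e. \<open>1\<close> or \<open>-1\<close>.\<close>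

definition integral_condition ::
  "complex \<Rightarrow> 'a measure \<Rightarrow> real \<Rightarrow> ('a \<Rightarrow> complex) \<Rightarrow> ('a \<Rightarrow> complex) \<Rightarrow> ('a \<Rightarrow> complex)
     \<Rightarrow> complex \<Rightarrow> complex \<Rightarrow> bool" where
  "integral_condition \<sigma> M lam f g h \<gamma> \<Gamma> \<longleftrightarrow>
     (LINT s|M. Re ((\<Gamma> * h s - (of_real lam * f s + \<sigma> * of_real (1 - lam) * g s))
        * (of_real lam * cnj (f s) + \<sigma> * of_real (1 - lam) * cnj (g s) - cnj \<gamma> * cnj (h s)))) \<ge> 0"

definition ball_condition ::
  "complex \<Rightarrow> 'a measure \<Rightarrow> real \<Rightarrow> ('a \<Rightarrow> complex) \<Rightarrow> ('a \<Rightarrow> complex) \<Rightarrow> ('a \<Rightarrow> complex)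
     \<Rightarrow> complex \<Rightarrow> complex \<Rightarrow> bool" where
  "ball_condition \<sigma> M lam f g h \<gamma> \<Gamma> \<longleftrightarrow>
     sqrt (LINT s|M. (cmod (of_real lam * f s + \<sigma> * of_real (1 - lam) * g s
        - (\<gamma> + \<Gamma>) / 2 * h s))\<^sup>2) \<le> 1/2 * cmod (\<Gamma> - \<gamma>)"

end

theory Submission
  imports Defs
begin

text \<open>
  Write \<open>P u = u - \<langle>u, h\<rangle> h\<close> for the projection onto the orthogonal complement of the unit vector \<open>h\<close>.
  Then \<open>I = Re \<langle>P f, P g\<rangle>\<close>, and for \<open>z = \<lambda> f \<plusminus> (1 - \<lambda>) g\<close> the parallelogram law gives
  \<open>\<plusminus> 4 \<lambda> (1 - \<lambda>) I \<le> \<parallel>P z\<parallel>\<^sup>2\<close>. Since \<open>P z\<close> is the shortest vector in \<open>z + \<complex> h\<close>, its norm is at most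
  \<open>\<parallel>z - (\<gamma> + \<Gamma>)/2 h\<parallel> \<le> |\<Gamma> - \<gamma>|/2\<close>. Equality holds for \<open>f = g \<bottom> h\<close> unit vectors,
  \<open>\<lambda> = 1/2\<close>, \<open>\<gamma> = -1\<close>, \<open>\<Gamma> = 1\<close>.
\<close>

section \<open>Square-integrable functions and their inner product\<close>

definition l2_inner :: "'a measure \<Rightarrow> ('a \<Rightarrow> complex) \<Rightarrow> ('a \<Rightarrow> complex) \<Rightarrow> complex" where
  "l2_inner M f g = (LINT s|M. f s * cnj (g s))"

text \<open>Embeds the real case in the complex one, so that the Hilbert space arguments are carried
  out over \<open>UNIV\<close> only, where complex coefficients are allowed.\<close>

lemma L2_space_mono: "K \<subseteq> L \<Longrightarrow> L2_space M K \<subseteq> L2_space M L"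
  by (auto simp: L2_space_def)

text \<open>The product is dominated by \<open>|f|^2 + |g|^2\<close>. This is what licenses
  linearity of \<open>l2_inner\<close>, as a Bochner integral defaults to 0 on non-integrable
  functions.\<close>

lemma L2_space_integrable_mult_cnj:
  assumes "f \<in> L2_space M K" "g \<in> L2_space M L"
  shows "integrable M (\<lambda>s. f s * cnj (g s))"
proof (rule Bochner_Integration.integrable_bound)
  show "integrable M (\<lambda>s. (cmod (f s))\<^sup>2 + (cmod (g s))\<^sup>2)"
    using assms by (auto simp: L2_space_def)
  have [measurable]: "f \<in> borel_measurable M" "g \<in> borel_measurable M"
    using assms by (auto simp: L2_space_def)
  have [measurable]: "cnj \<in> borel_measurable borel"
    by (intro borel_measurable_continuous_onI continuous_intros)
  show "(\<lambda>s. f s * cnj (g s)) \<in> borel_measurable M"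
    by measurable
  have "cmod (f s * cnj (g s)) \<le> norm ((cmod (f s))\<^sup>2 + (cmod (g s))\<^sup>2)" for s
  proof -
    have "2 * cmod (f s) * cmod (g s) \<le> (cmod (f s))\<^sup>2 + (cmod (g s))\<^sup>2"
      by (rule sum_squares_bound)
    moreover have "0 \<le> cmod (f s) * cmod (g s)" by simp
    ultimately have "cmod (f s) * cmod (g s) \<le> (cmod (f s))\<^sup>2 + (cmod (g s))\<^sup>2" by linarith
    then show ?thesis by (simp add: norm_mult)
  qed
  then show "AE s in M. cmod (f s * cnj (g s)) \<le> norm ((cmod (f s))\<^sup>2 + (cmod (g s))\<^sup>2)"
    by simp
qed

lemma L2_space_lincomb:
  assumes "f \<in> L2_space M UNIV" "g \<in> L2_space M UNIV"
  shows "(\<lambda>s. a * f s + b * g s) \<in> L2_space M UNIV"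
proof -
  have [measurable]: "f \<in> borel_measurable M" "g \<in> borel_measurable M"
    using assms by (auto simp: L2_space_def)
  have "integrable M (\<lambda>s. (cmod (a * f s + b * g s))\<^sup>2)"
  proof (rule Bochner_Integration.integrable_bound)
    show "integrable M (\<lambda>s. 2 * ((cmod a)\<^sup>2 * (cmod (f s))\<^sup>2) + 2 * ((cmod b)\<^sup>2 * (cmod (g s))\<^sup>2))"
      using assms by (auto simp: L2_space_def)
    show "(\<lambda>s. (cmod (a * f s + b * g s))\<^sup>2) \<in> borel_measurable M"
      by measurable
    have "(cmod (x + y))\<^sup>2 \<le> 2 * (cmod x)\<^sup>2 + 2 * (cmod y)\<^sup>2" for x y
    proof -
      have "(cmod (x + y))\<^sup>2 \<le> (cmod x + cmod y)\<^sup>2"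
        by (intro power_mono norm_triangle_ineq) simp
      also have "\<dots> \<le> 2 * (cmod x)\<^sup>2 + 2 * (cmod y)\<^sup>2"
        using sum_squares_bound[of "cmod x" "cmod y"] by (simp add: power2_sum)
      finally show ?thesis .
    qed
    from this[of "a * f _" "b * g _"]
    show "AE s in M. norm ((cmod (a * f s + b * g s))\<^sup>2)
      \<le> norm (2 * ((cmod a)\<^sup>2 * (cmod (f s))\<^sup>2) + 2 * ((cmod b)\<^sup>2 * (cmod (g s))\<^sup>2))"
      by (simp add: norm_mult power_mult_distrib)
  qed
  then show ?thesis
    by (simp add: L2_space_def)
qed

lemma l2_inner_lincomb_left:
  assumes "f \<in> L2_space M UNIV" "g \<in> L2_space M UNIV" "h \<in> L2_space M UNIV"
  shows "l2_inner M (\<lambda>s. a * f s + b * g s) h = a * l2_inner M f h + b * l2_inner M g h"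
  using L2_space_integrable_mult_cnj[OF assms(1,3)] L2_space_integrable_mult_cnj[OF assms(2,3)]
  by (simp add: l2_inner_def distrib_right mult.assoc)

lemma l2_inner_commute: "l2_inner M g f = cnj (l2_inner M f g)"
  unfolding l2_inner_def Bochner_Integration.integral_cnj[symmetric] by (simp add: mult.commute)

lemma l2_inner_lincomb_right:
  assumes "f \<in> L2_space M UNIV" "g \<in> L2_space M UNIV" "h \<in> L2_space M UNIV"
  shows "l2_inner M h (\<lambda>s. a * f s + b * g s) = cnj a * l2_inner M h f + cnj b * l2_inner M h g"
  by (subst l2_inner_commute)
     (simp add: l2_inner_lincomb_left[OF assms] l2_inner_commute[of M h f] l2_inner_commute[of M h g])

lemma l2_inner_self: "l2_inner M f f = of_real (LINT s|M. (cmod (f s))\<^sup>2)"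
  by (simp add: l2_inner_def complex_norm_square[symmetric] flip: integral_complex_of_real)

section \<open>The functional \<open>I\<close> as a semi-inner product\<close>

lemma gruss_functional_eq:
  assumes "f \<in> L2_space M UNIV" "g \<in> L2_space M UNIV"
  shows "gruss_functional M f g h = Re (l2_inner M f g) - Re (l2_inner M f h * l2_inner M h g)"
  using L2_space_integrable_mult_cnj[OF assms]
  unfolding gruss_functional_def l2_inner_def by (subst integral_Re) auto

text \<open>Pythagoras: \<open>z - c h = P z + (\<langle>z, h\<rangle> - c) h\<close> is an
  orthogonal sum, and \<open>gruss_functional M z z h\<close> is the squared norm of
  \<open>P z\<close>. The proof completes the square in \<open>c\<close> without introducing
  \<open>P\<close>.\<close>

lemma lint_cmod_diff_mult_sq:
  assumes z: "z \<in> L2_space M UNIV" and h: "h \<in> L2_space M UNIV"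
    and h1: "(LINT s|M. (cmod (h s))\<^sup>2) = 1"
  shows "(LINT s|M. (cmod (z s - c * h s))\<^sup>2)
    = gruss_functional M z z h + (cmod (c - l2_inner M z h))\<^sup>2"
proof -
  let ?w = "\<lambda>s. 1 * z s + (- c) * h s"
  let ?p = "l2_inner M z h"
  have w: "?w \<in> L2_space M UNIV"
    by (rule L2_space_lincomb[OF z h])
  have hh: "l2_inner M h h = 1"
    by (simp add: l2_inner_self h1)
  have "l2_inner M ?w ?w = l2_inner M z z - cnj c * ?p - c * cnj ?p + c * cnj c"
    unfolding l2_inner_lincomb_left[OF z h w]
    unfolding l2_inner_lincomb_right[OF z h z] l2_inner_lincomb_right[OF z h h]
    using l2_inner_commute[of M h z] by (simp add: hh algebra_simps)
  also have "\<dots> = (l2_inner M z z - ?p * cnj ?p) + (c - ?p) * cnj (c - ?p)"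
    by (simp add: algebra_simps)
  also have "(c - ?p) * cnj (c - ?p) = of_real ((cmod (c - ?p))\<^sup>2)"
    by (rule complex_norm_square[symmetric])
  finally have "Re (l2_inner M ?w ?w) = gruss_functional M z z h + (cmod (c - ?p))\<^sup>2"
    using l2_inner_commute[of M h z] by (simp add: gruss_functional_eq[OF z z])
  then show ?thesis
    by (simp add: l2_inner_self)
qed

lemma gruss_functional_self_le:
  assumes "z \<in> L2_space M UNIV" "h \<in> L2_space M UNIV" "(LINT s|M. (cmod (h s))\<^sup>2) = 1"
  shows "gruss_functional M z z h \<le> (LINT s|M. (cmod (z s - c * h s))\<^sup>2)"
  by (simp add: lint_cmod_diff_mult_sq[OF assms])

lemma gruss_functional_self_nonneg:
  assumes "z \<in> L2_space M UNIV" "h \<in> L2_space M UNIV" "(LINT s|M. (cmod (h s))\<^sup>2) = 1"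
  shows "0 \<le> gruss_functional M z z h"
proof -
  \<comment> \<open>This choice of \<open>c\<close> makes the extra square vanish.\<close>
  have "gruss_functional M z z h = (LINT s|M. (cmod (z s - l2_inner M z h * h s))\<^sup>2)"
    by (simp add: lint_cmod_diff_mult_sq[OF assms])
  then show ?thesis
    by simp
qed

text \<open>The two cross terms are complex conjugates of each other; since \<open>a\<close> and
  \<open>b\<close> are real, their real parts agree and add up to the factor 2.\<close>

lemma gruss_functional_polarization:
  assumes f: "f \<in> L2_space M UNIV" and g: "g \<in> L2_space M UNIV" and h: "h \<in> L2_space M UNIV"
  shows "gruss_functional M (\<lambda>s. of_real a * f s + of_real b * g s)
           (\<lambda>s. of_real a * f s + of_real b * g s) h =
         a\<^sup>2 * gruss_functional M f f h + b\<^sup>2 * gruss_functional M g g h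
           + 2 * a * b * gruss_functional M f g h"
proof -
  let ?z = "\<lambda>s. of_real a * f s + of_real b * g s"
  have z: "?z \<in> L2_space M UNIV"
    by (rule L2_space_lincomb[OF f g])
  have c: "l2_inner M g f = cnj (l2_inner M f g)" "l2_inner M h f = cnj (l2_inner M f h)"
    "l2_inner M h g = cnj (l2_inner M g h)"
    by (rule l2_inner_commute)+
  show ?thesis
    unfolding gruss_functional_eq[OF z z] gruss_functional_eq[OF f f] gruss_functional_eq[OF g g]
      gruss_functional_eq[OF f g] l2_inner_lincomb_left[OF f g z] l2_inner_lincomb_left[OF f g h]
      l2_inner_lincomb_right[OF f g f] l2_inner_lincomb_right[OF f g g]
      l2_inner_lincomb_right[OF f g h] c
    by (simp add: algebra_simps power2_eq_square)
qed

section \<open>Equivalence of the two forms of the hypothesis\<close>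

text \<open>With \<open>d = (p - q)/2\<close> and \<open>w = z - (p + q)/2\<close> the factors are
  \<open>d - w\<close> and \<open>cnj (d + w)\<close>, whose product has real part
  \<open>|d|^2 - |w|^2\<close>.\<close>

lemma Re_mult_cnj_eq_midpoint:
  "Re ((p - z) * cnj (z - q)) = (cmod (p - q))\<^sup>2 / 4 - (cmod (z - (p + q) / 2))\<^sup>2"
  unfolding cmod_power2 by (simp add: power2_eq_square field_simps)

text \<open>The midpoint identity is applied at each point with \<open>p = \<Gamma> h(s)\<close> and
  \<open>q = \<gamma> h(s)\<close>; integrating it turns the factor \<open>|h(s)|^2\<close> into
  1.\<close>

lemma integral_condition_iff_bound:
  assumes "gruss_setting K M lam f g h \<gamma> \<Gamma>" and \<sigma>: "\<sigma> \<in> {1, -1}"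
  shows "integral_condition \<sigma> M lam f g h \<gamma> \<Gamma> \<longleftrightarrow>
    (LINT s|M. (cmod (of_real lam * f s + \<sigma> * of_real (1 - lam) * g s - (\<gamma> + \<Gamma>) / 2 * h s))\<^sup>2)
      \<le> (cmod (\<Gamma> - \<gamma>))\<^sup>2 / 4"
proof -
  have L: "f \<in> L2_space M UNIV" "g \<in> L2_space M UNIV" "h \<in> L2_space M UNIV"
    and h1: "(LINT s|M. (cmod (h s))\<^sup>2) = 1"
    using assms L2_space_mono[of K UNIV M] by (auto simp: gruss_setting_def)
  let ?z = "\<lambda>s. of_real lam * f s + \<sigma> * of_real (1 - lam) * g s"
  let ?w = "\<lambda>s. 1 * ?z s + (- ((\<gamma> + \<Gamma>) / 2)) * h s"
  have "?w \<in> L2_space M UNIV"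
    by (intro L2_space_lincomb L)
  then have iw: "integrable M (\<lambda>s. (cmod (?z s - (\<gamma> + \<Gamma>) / 2 * h s))\<^sup>2)"
    by (simp add: L2_space_def)
  have ih: "integrable M (\<lambda>s. (cmod (h s))\<^sup>2)"
    using L by (simp add: L2_space_def)
  have "Re ((\<Gamma> * h s - ?z s)
        * (of_real lam * cnj (f s) + \<sigma> * of_real (1 - lam) * cnj (g s) - cnj \<gamma> * cnj (h s)))
      = (cmod (\<Gamma> - \<gamma>))\<^sup>2 / 4 * (cmod (h s))\<^sup>2
        - (cmod (?z s - (\<gamma> + \<Gamma>) / 2 * h s))\<^sup>2" for s
  proof -
    have "of_real lam * cnj (f s) + \<sigma> * of_real (1 - lam) * cnj (g s) - cnj \<gamma> * cnj (h s)
        = cnj (?z s - \<gamma> * h s)"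
      \<comment> \<open>Both signs are real, so \<open>\<sigma>\<close> equals its own
        conjugate.\<close>
      using \<sigma> by auto
    moreover have "(\<Gamma> * h s + \<gamma> * h s) / 2 = (\<gamma> + \<Gamma>) / 2 * h s"
      by (simp add: field_simps)
    moreover have "(cmod (\<Gamma> * h s - \<gamma> * h s))\<^sup>2 = (cmod (\<Gamma> - \<gamma>))\<^sup>2 * (cmod (h s))\<^sup>2"
      by (simp add: norm_mult power_mult_distrib flip: left_diff_distrib)
    ultimately show ?thesis
      by (simp only: Re_mult_cnj_eq_midpoint times_divide_eq_left)
  qed
  then show ?thesis
    using iw ih h1 by (simp add: integral_condition_def)
qed

lemma integral_condition_iff_ball_condition:
  assumes "gruss_setting K M lam f g h \<gamma> \<Gamma>" and "\<sigma> \<in> {1, -1}"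
  shows "integral_condition \<sigma> M lam f g h \<gamma> \<Gamma> \<longleftrightarrow> ball_condition \<sigma> M lam f g h \<gamma> \<Gamma>"
proof -
  have "sqrt x \<le> 1/2 * y \<longleftrightarrow> x \<le> y\<^sup>2 / 4" if "0 \<le> y" for x y :: real
    using that real_sqrt_le_iff[of x "(y / 2)\<^sup>2"] by (simp add: power_divide real_sqrt_divide del: real_sqrt_le_iff)
  then show ?thesis
    unfolding integral_condition_iff_bound[OF assms] ball_condition_def by simp
qed

section \<open>The upper bounds for both signs\<close>

lemma gruss_functional_signed_le:
  assumes S: "gruss_setting K M lam f g h \<gamma> \<Gamma>" and \<tau>: "\<tau> \<in> {1, -1}"
    and C: "integral_condition (of_real \<tau>) M lam f g h \<gamma> \<Gamma>"
  shows "\<tau> * gruss_functional M f g h \<le> 1/16 * (1 / (lam * (1 - lam))) * (cmod (\<Gamma> - \<gamma>))\<^sup>2"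
proof -
  have L: "f \<in> L2_space M UNIV" "g \<in> L2_space M UNIV" "h \<in> L2_space M UNIV"
    and h1: "(LINT s|M. (cmod (h s))\<^sup>2) = 1" and lam: "0 < lam" "lam < 1"
    using S L2_space_mono[of K UNIV M] by (auto simp: gruss_setting_def)
  \<comment> \<open>The sign is absorbed into \<open>b\<close>, so that \<open>?z\<close> is the
    combination in the hypothesis and \<open>?y\<close> is its partner in the parallelogram
    law.\<close>
  define b where "b = \<tau> * (1 - lam)"
  let ?z = "\<lambda>s. of_real lam * f s + of_real b * g s"
  let ?y = "\<lambda>s. of_real lam * f s + of_real (- b) * g s"
  have z: "?z \<in> L2_space M UNIV" and y: "?y \<in> L2_space M UNIV"
    by (intro L2_space_lincomb L)+
  have "gruss_functional M ?z ?z h \<le> (LINT s|M. (cmod (?z s - (\<gamma> + \<Gamma>) / 2 * h s))\<^sup>2)"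
    by (rule gruss_functional_self_le[OF z L(3) h1])
  also have "\<dots> \<le> (cmod (\<Gamma> - \<gamma>))\<^sup>2 / 4"
    using integral_condition_iff_bound[OF S, of "of_real \<tau>"] C \<tau> by (auto simp: b_def)
  finally have "gruss_functional M ?z ?z h \<le> (cmod (\<Gamma> - \<gamma>))\<^sup>2 / 4" .
  moreover have "0 \<le> gruss_functional M ?y ?y h"
    by (rule gruss_functional_self_nonneg[OF y L(3) h1])
  \<comment> \<open>By polarization the left side is the value of the functional at
    \<open>?z\<close> minus its value at \<open>?y\<close>, because the pure square terms
    cancel.\<close>
  ultimately have "4 * lam * b * gruss_functional M f g h \<le> (cmod (\<Gamma> - \<gamma>))\<^sup>2 / 4"
    unfolding gruss_functional_polarization[OF L] by simp
  then have "16 * (lam * (1 - lam)) * (\<tau> * gruss_functional M f g h) \<le> (cmod (\<Gamma> - \<gamma>))\<^sup>2"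
    by (simp add: b_def algebra_simps)
  moreover have "0 < lam * (1 - lam)"
    using lam by simp
  ultimately show ?thesis
    by (simp add: field_simps)
qed

section \<open>Sharpness of the constant\<close>

text \<open>The extremal example lives on two points of \<open>nat\<close>: an arbitrary carrier
  type might be too small for two orthogonal unit vectors. All values are 0 or 1 and the scalars are
  real, so it serves both fields.\<close>

lemma gruss_constant_sharp:
  fixes K :: "complex set"
  assumes "\<real> \<subseteq> K"
  obtains M :: "nat measure" and lam f g h \<gamma> \<Gamma> where
    "gruss_setting K M lam f g h \<gamma> \<Gamma>" "integral_condition 1 M lam f g h \<gamma> \<Gamma>"
    "gruss_functional M f g h = 1" "1 / (lam * (1 - lam)) * (cmod (\<Gamma> - \<gamma>))\<^sup>2 = 16"
proof
  \<comment> \<open>Here \<open>f = g\<close> and \<open>h\<close> are the two coordinate vectors.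
    The centre \<open>(\<gamma> + \<Gamma>)/2\<close> is 0 and the radius is 1, so \<open>f\<close>
    lies on the boundary of the ball.\<close>
  let ?M = "count_space {0, 1 :: nat}" and ?lam = "1/2 :: real"
  let ?f = "\<lambda>s :: nat. if s = 1 then 1 else 0 :: complex"
  let ?h = "\<lambda>s :: nat. if s = 0 then 1 else 0 :: complex"
  have K: "0 \<in> K" "1 \<in> K" "- 1 \<in> K"
    using assms by auto
  show "gruss_setting K ?M ?lam ?f ?f ?h (-1) 1"
    using K by (simp add: gruss_setting_def L2_space_def integrable_count_space
        lebesgue_integral_count_space_finite)
  show "integral_condition 1 ?M ?lam ?f ?f ?h (-1) 1"
    by (simp add: integral_condition_def lebesgue_integral_count_space_finite)
  show "gruss_functional ?M ?f ?f ?h = 1"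
    by (simp add: gruss_functional_def lebesgue_integral_count_space_finite)
  show "1 / (?lam * (1 - ?lam)) * (cmod (1 - (-1)))\<^sup>2 = 16"
    by simp
qed

theorem proposition2:
  fixes K :: "complex set"
  assumes "K = UNIV \<or> K = \<real>"
  shows
    "(\<forall>(M :: 'a measure) lam f g h \<gamma> \<Gamma>. gruss_setting K M lam f g h \<gamma> \<Gamma> \<longrightarrow>
        (integral_condition 1 M lam f g h \<gamma> \<Gamma> \<longleftrightarrow> ball_condition 1 M lam f g h \<gamma> \<Gamma>) \<and>
        (integral_condition 1 M lam f g h \<gamma> \<Gamma> \<longrightarrow>
           gruss_functional M f g h \<le> 1/16 * (1 / (lam * (1 - lam))) * (cmod (\<Gamma> - \<gamma>))\<^sup>2))
     \<and> (\<forall>c < 1/16. \<not> (\<forall>(M :: nat measure) lam f g h \<gamma> \<Gamma>.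
          gruss_setting K M lam f g h \<gamma> \<Gamma> \<longrightarrow>
          integral_condition 1 M lam f g h \<gamma> \<Gamma> \<longrightarrow>
          gruss_functional M f g h \<le> c * (1 / (lam * (1 - lam))) * (cmod (\<Gamma> - \<gamma>))\<^sup>2))
     \<and> (\<forall>(M :: 'a measure) lam f g h \<gamma> \<Gamma>. gruss_setting K M lam f g h \<gamma> \<Gamma> \<longrightarrow>
          (\<forall>\<sigma> \<in> {1, -1}.
             integral_condition \<sigma> M lam f g h \<gamma> \<Gamma> \<longleftrightarrow> ball_condition \<sigma> M lam f g h \<gamma> \<Gamma>) \<and>
          ((\<forall>\<sigma> \<in> {1, -1}. integral_condition \<sigma> M lam f g h \<gamma> \<Gamma>) \<longrightarrow>
             \<bar>gruss_functional M f g h\<bar> \<le> 1/16 * (1 / (lam * (1 - lam))) * (cmod (\<Gamma> - \<gamma>))\<^sup>2))"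
proof -
  have lower: "\<not> (\<forall>(M :: nat measure) lam f g h \<gamma> \<Gamma>.
          gruss_setting K M lam f g h \<gamma> \<Gamma> \<longrightarrow>
          integral_condition 1 M lam f g h \<gamma> \<Gamma> \<longrightarrow>
          gruss_functional M f g h \<le> c * (1 / (lam * (1 - lam))) * (cmod (\<Gamma> - \<gamma>))\<^sup>2)"
    (is "\<not> ?best") if "c < 1/16" for c
  proof
    assume best: ?best
    have "\<real> \<subseteq> K"
      using assms by auto
    then obtain M :: "nat measure" and lam f g h \<gamma> \<Gamma> where
      "gruss_setting K M lam f g h \<gamma> \<Gamma>" "integral_condition 1 M lam f g h \<gamma> \<Gamma>"
      and I: "gruss_functional M f g h = 1" "1 / (lam * (1 - lam)) * (cmod (\<Gamma> - \<gamma>))\<^sup>2 = 16"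
      by (rule gruss_constant_sharp)
    with best have "gruss_functional M f g h \<le> c * (1 / (lam * (1 - lam))) * (cmod (\<Gamma> - \<gamma>))\<^sup>2"
      by blast
    then have "1 \<le> c * 16"
      unfolding mult.assoc I .
    with that show False
      by simp
  qed
  have upper: "gruss_functional M f g h \<le> 1/16 * (1 / (lam * (1 - lam))) * (cmod (\<Gamma> - \<gamma>))\<^sup>2"
    if "gruss_setting K M lam f g h \<gamma> \<Gamma>" "integral_condition 1 M lam f g h \<gamma> \<Gamma>"
    for M :: "'a measure" and lam f g h \<gamma> \<Gamma>
    using gruss_functional_signed_le[OF that(1), of 1] that(2) by simp
  \<comment> \<open>The sign \<open>-1\<close> bounds \<open>I\<close> from below; together with
    \<open>upper\<close> this bounds its absolute value.\<close>
  have "- gruss_functional M f g h \<le> 1/16 * (1 / (lam * (1 - lam))) * (cmod (\<Gamma> - \<gamma>))\<^sup>2"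
    if "gruss_setting K M lam f g h \<gamma> \<Gamma>" "integral_condition (- 1) M lam f g h \<gamma> \<Gamma>"
    for M :: "'a measure" and lam f g h \<gamma> \<Gamma>
    using gruss_functional_signed_le[OF that(1), of "- 1"] that(2) by simp
  with upper have
    abs: "\<bar>gruss_functional M f g h\<bar> \<le> 1/16 * (1 / (lam * (1 - lam))) * (cmod (\<Gamma> - \<gamma>))\<^sup>2"
    if "gruss_setting K M lam f g h \<gamma> \<Gamma>" "\<forall>\<sigma> \<in> {1, -1}. integral_condition \<sigma> M lam f g h \<gamma> \<Gamma>"
    for M :: "'a measure" and lam f g h \<gamma> \<Gamma>
    using that by (intro abs_leI) blast+
  show ?thesis
    using lower
    by (intro conjI allI impI ballI integral_condition_iff_ball_condition upper abs) auto
qed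

end
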